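(* Let $p,q,r$ be integers $\ge 3$ that are pairwise relatively prime, and let $s\ge 1$ be an integer with $r\equiv s\pmod{pq}$ or $r\equiv -s\pmod{pq}$, and $r>\max(p,q)>s\ge 1$. Then \[ A(p,q,s)\le A(p,q,r)\le A(p,q,s)+1 . \]
   Context: For pairwise relatively prime integers $p,q,r\ge 3$, the ternary inclusion-exclusion polynomial is \[ Q_{\{p,q,r\}}(z)=\frac{(z^{pqr}-1)(z^p-1)(z^q-1)(z^r-1)}{(z^{pq}-1)(z^{qr}-1)(z^{rp}-1)(z-1)}, \] a polynomial with integer coefficients $a_m$, and $A(p,q,r)=\max_m |a_m|$ is the maximum absolute value of its coefficients. The function $A$ is symmetric in its three arguments. By convention, for $s=1$ or $s=2$ (with $p,q,s$ pairwise relatively prime) one sets $A(p,q,s)=s-1$. (Under the hypotheses, $\gcd(s,pq)=1$, so $p,q,s$ are pairwise relatively prime; when $s\ge 3$, $A(p,q,s)$ is defined by the polynomial above.) *)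

theory Defs
  imports "HOL-Computational_Algebra.Polynomial" "HOL-Number_Theory.Cong"
begin

(* For pairwise coprime positive p, q, r the denominator divides the numerator in Z[z],
   so div is exact polynomial division here. *)
definition ternary_incl_excl_poly :: "nat \<Rightarrow> nat \<Rightarrow> nat \<Rightarrow> int poly" where
  "ternary_incl_excl_poly p q r =
     ((monom 1 (p * q * r) - 1) * (monom 1 p - 1) * (monom 1 q - 1) * (monom 1 r - 1)) div
     ((monom 1 (p * q) - 1) * (monom 1 (q * r) - 1) * (monom 1 (r * p) - 1) * (monom 1 1 - 1))"

definition height :: "int poly \<Rightarrow> int" where
  "height f = Max ((\<lambda>m. \<bar>coeff f m\<bar>) ` {..degree f})"

(* The value s - 1 for s = 1, 2 is a convention: for s = 1 the quotient of polynomials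
   above is 1, which has height 1 rather than 0. *)
definition A :: "nat \<Rightarrow> nat \<Rightarrow> nat \<Rightarrow> int" where
  "A p q s = (if s = 1 \<or> s = 2 then int s - 1 else height (ternary_incl_excl_poly p q s))"

end

theory Submission
  imports Defs "HOL-Computational_Algebra.Polynomial_Factorial" "HOL-Computational_Algebra.Polynomial_FPS"
begin

text \<open>
  Let \<open>Q(z) = (z^(p q) - 1) (z - 1) / ((z^p - 1) (z^q - 1))\<close>, so that the ternary polynomial is
  \<open>Q(z^r) / Q(z)\<close>. The coefficients of \<open>Q\<close> are \<open>c m = chi m - chi (m - 1)\<close>, where \<open>chi\<close> is the
  indicator of the semigroup generated by \<open>p\<close> and \<open>q\<close>, and those of \<open>1 / Q\<close> are \<open>p q\<close>-periodic, given by
  \<open>w\<close> with values \<open>1\<close> on \<open>[0, p)\<close>, \<open>- 1\<close> on \<open>[q, p + q)\<close> and \<open>0\<close> elsewhere (for \<open>p < q\<close>). Hence the coefficient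
  of \<open>z^(r N + t)\<close> with \<open>0 \<le> t < r\<close> is \<open>T r N t = (\<Sum>m=0..N. c m * w (t + r * (N - m)))\<close>.

  For arbitrary \<open>t\<close>, the supremum \<open>M\<close> of the absolute values of \<open>T r N t\<close> depends only on \<open>r\<close> modulo
  \<open>p q\<close>, and not on its sign because \<open>w (p + q - 1 - t) = - w t\<close>. The recurrence
  \<open>T r N t = T r (N - 1) (t + r) + c N * w t\<close> moves \<open>t\<close> into \<open>[0, r)\<close>. If \<open>r > q\<close> this can be done without
  losing anything, so \<open>A p q r = M\<close>. For smaller \<open>s\<close> the path can be chosen to meet only one of the
  two intervals where \<open>w\<close> is nonzero, and it collects there a telescoping sum of consecutive \<open>c\<close>'s,
  which is at most \<open>1\<close> in absolute value. Hence \<open>A p q s \<le> M \<le> A p q s + 1\<close>.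
\<close>

section \<open>Exactness of the defining quotient\<close>

abbreviation bin :: "nat \<Rightarrow> int poly" where
  "bin n \<equiv> monom 1 n - 1"

lemma bin_mult: "bin (a * k) = bin a * (\<Sum>i<k. monom 1 a ^ i)"
  using power_diff_1_eq[of "monom 1 a :: int poly" k] by (simp add: monom_power)

lemma bin_dvd: "a dvd b \<Longrightarrow> bin a dvd bin b"
  by (auto simp: bin_mult elim!: dvdE)

lemma bin_neq_0: "n > 0 \<Longrightarrow> bin n \<noteq> 0"
  by (auto dest: arg_cong[where f = "\<lambda>f. coeff f n"])

lemma lead_coeff_bin: "n > 0 \<Longrightarrow> lead_coeff (bin n) = 1"
proof -
  assume n: "n > 0"
  have "degree (bin n) = n"
  proof (rule antisym)
    show "degree (bin n) \<le> n"
      by (rule degree_le) (use n in auto)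
    show "n \<le> degree (bin n)"
      by (rule le_degree) (use n in auto)
  qed
  then show ?thesis using n by simp
qed

text \<open>With \<open>a * x = b * y + gcd a b\<close>, both \<open>z^(a x)\<close> and
  \<open>z^(b y)\<close> are 1 modulo \<open>g\<close>, hence so is
  \<open>z^(gcd a b)\<close>.\<close>

lemma dvd_bin_gcd:
  assumes "g dvd bin a" "g dvd bin b" "a > 0"
  shows "g dvd bin (gcd a b)"
proof -
  obtain x y where xy: "a * x = b * y + gcd a b"
    using bezout_nat[of a b] assms(3) by auto
  have 1: "g dvd bin (a * x)" "g dvd bin (b * y)"
    using assms(1,2) bin_dvd[of a "a * x"] bin_dvd[of b "b * y"] by (auto intro: dvd_trans)
  have "bin (gcd a b) = bin (a * x) - monom 1 (gcd a b) * bin (b * y)"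
    unfolding xy by (simp add: algebra_simps mult_monom)
  then show ?thesis using 1 by (metis dvd_diff dvd_mult)
qed

text \<open>\<open>K\<close> is a sum of \<open>k\<close> powers, each 1 modulo
  \<open>bin a\<close>, so a common divisor divides the constant \<open>k\<close>. Over the integers
  this only makes it constant; it is a unit because \<open>bin a\<close> is monic.\<close>

lemma coprime_bin_quotient:
  assumes "bin (a * k) = bin a * K" "a > 0" "k > 0"
  shows "coprime (bin a) K"
proof (rule coprimeI)
  fix g assume g: "g dvd bin a" "g dvd K"
  let ?x = "monom 1 a :: int poly"
  have K: "K = (\<Sum>i<k. ?x ^ i)"
    using assms bin_mult[of a k] bin_neq_0[of a] by simp
  have "bin a dvd (\<Sum>i<k. ?x ^ i - 1)"
    by (rule dvd_sum) (metis dvd_triv_left power_diff_1_eq)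
  then have "g dvd K - of_nat k"
    using g(1) by (auto simp: K sum_subtractf intro: dvd_trans)
  then have "g dvd of_nat k"
    using g(2) by (metis dvd_diff diff_diff_eq2 add_diff_cancel_left')
  then have "degree g = 0"
    using dvd_imp_degree_le[of g "of_nat k"] assms(3) by auto
  moreover have "lead_coeff g dvd 1"
  proof -
    obtain h where "bin a = g * h" using g(1) by (elim dvdE)
    then have "lead_coeff g * lead_coeff h = 1"
      using lead_coeff_bin[OF assms(2)] by (simp add: lead_coeff_mult)
    then show ?thesis by (metis dvd_triv_left)
  qed
  ultimately show "is_unit g"
    by (metis degree_0_id is_unit_const_poly_iff)
qed

text \<open>After cancelling \<open>bin r\<close>, the factors \<open>F\<close> and \<open>G\<close>
  both divide \<open>H\<close>. They are coprime: a common divisor divides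
  \<open>bin (gcd (r * a) (r * b)) = bin r\<close>, which is coprime to \<open>F\<close>.\<close>

lemma binary_quotient_exists:
  assumes "coprime a b" "a > 0" "b > 0" "r > 0"
  shows "\<exists>Q. bin (a * r) * bin (b * r) * Q = bin (a * b * r) * bin r"
proof -
  obtain F where F: "bin (r * a) = bin r * F" using bin_mult by blast
  obtain G where G: "bin (r * b) = bin r * G" using bin_mult by blast
  obtain H where H: "bin (r * (a * b)) = bin r * H" using bin_mult by blast
  have nz: "bin r \<noteq> 0" using bin_neq_0 assms by simp
  have "bin (r * a) dvd bin (r * (a * b))" "bin (r * b) dvd bin (r * (a * b))"
    by (rule bin_dvd; simp)+
  then have FG: "F dvd H" "G dvd H"
    using nz unfolding F G H by auto
  have "coprime F G"
  proof (rule coprimeI)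
    fix g assume g: "g dvd F" "g dvd G"
    have "g dvd bin (gcd (r * a) (r * b))"
      using g assms by (intro dvd_bin_gcd) (auto simp: F G)
    then have "g dvd bin r" using assms(1) by (simp add: gcd_mult_distrib_nat[symmetric])
    moreover have "coprime (bin r) F" using coprime_bin_quotient[OF F] assms by simp
    ultimately show "is_unit g" using g by (meson coprime_common_divisor)
  qed
  then have "F * G dvd H" using FG by (simp add: divides_mult)
  then obtain Q where "H = F * G * Q" by (elim dvdE)
  then show ?thesis using F G H
    by (intro exI[of _ Q]) (simp add: ac_simps)
qed

text \<open>The quotient is \<open>Q' / Q\<close>, where \<open>Q'\<close> is \<open>Q\<close> with
  \<open>z^r\<close> in place of \<open>z\<close>. \<open>Q\<close> divides
  \<open>bin (p * q * r)\<close>, and coprimality to \<open>bin (p * r)\<close> and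
  \<open>bin (q * r)\<close> forces it to divide \<open>Q'\<close>.\<close>

lemma ternary_quotient_exists:
  assumes "coprime p q" "coprime q r" "coprime p r" "p > 0" "q > 0" "r > 0"
  shows "\<exists>P. bin (p * q * r) * bin p * bin q * bin r =
             P * (bin (p * q) * bin (q * r) * bin (r * p) * bin 1)"
proof -
  obtain Q where Q: "bin p * bin q * Q = bin (p * q) * bin 1"
    using binary_quotient_exists[of p q 1] assms by auto
  obtain Q' where Q': "bin (p * r) * bin (q * r) * Q' = bin (p * q * r) * bin r"
    using binary_quotient_exists[of p q r] assms by auto
  \<comment> \<open>A common divisor divides both \<open>bin (a * b) / bin a\<close> and
    \<open>bin a\<close>, which are coprime. The form in \<open>a\<close> and \<open>b\<close>
    serves both orders of \<open>p\<close> and \<open>q\<close>.\<close>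
  have cop: "coprime Q (bin (a * r))"
    if ab: "bin a * bin b * Q = bin (a * b) * bin 1" "coprime b r" "a > 0" "b > 0" for a b
  proof (rule coprimeI)
    fix g assume g: "g dvd Q" "g dvd bin (a * r)"
    obtain K where K: "bin (a * b) = bin a * K" using bin_mult by blast
    obtain L where L: "bin (1 * b) = bin 1 * L" using bin_mult by blast
    have "bin a * bin 1 * (L * Q) = bin a * bin 1 * K"
      using ab(1) K L by (simp add: ac_simps)
    then have "L * Q = K"
      using bin_neq_0[of a] bin_neq_0[of 1] ab by simp
    then have gK: "g dvd K" using g by auto
    then have "g dvd bin (a * b)" using K by simp
    then have "g dvd bin (gcd (a * b) (a * r))" using g ab by (intro dvd_bin_gcd) auto
    then have "g dvd bin a" using ab(2) by (simp add: gcd_mult_distrib_nat[symmetric])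
    then show "is_unit g"
      using coprime_bin_quotient[OF K] ab gK by (meson coprime_common_divisor)
  qed
  have c1: "coprime Q (bin (p * r))" using cop[of p q] Q assms by simp
  have c2: "coprime Q (bin (q * r))" using cop[of q p] Q assms by (simp add: ac_simps)
  have "Q dvd bin (p * q)"
  proof -
    obtain K where K: "bin (p * q) = bin p * K" using bin_mult by blast
    obtain L where L: "bin (1 * q) = bin 1 * L" using bin_mult by blast
    have "bin p * bin 1 * (L * Q) = bin p * bin 1 * K"
      using Q K L by (simp add: ac_simps)
    then have "L * Q = K"
      using bin_neq_0[of p] bin_neq_0[of 1] assms by simp
    then show ?thesis using K by auto
  qed
  then have "Q dvd bin (p * q * r)"
    using bin_dvd[of "p * q" "p * q * r"] by (auto intro: dvd_trans)
  then have "Q dvd bin (p * r) * bin (q * r) * Q'" by (simp add: Q')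
  then have "Q dvd Q'" using c1 c2
    by (simp add: coprime_dvd_mult_right_iff mult.assoc)
  then obtain P where P: "Q' = Q * P" by (elim dvdE)
  have "bin (p * q * r) * bin p * bin q * bin r = bin p * bin q * (bin (p * r) * bin (q * r) * Q')"
    by (subst Q') (simp only: ac_simps)
  also have "\<dots> = P * (bin (p * r) * bin (q * r) * (bin p * bin q * Q))"
    by (simp only: P ac_simps)
  also have "\<dots> = P * (bin (p * q) * bin (q * r) * bin (r * p) * bin 1)"
    by (subst Q) (simp only: ac_simps)
  finally show ?thesis by blast
qed

lemma ternary_incl_excl_poly_mult:
  assumes "coprime p q" "coprime q r" "coprime p r" "p > 0" "q > 0" "r > 0"
  shows "ternary_incl_excl_poly p q r * (bin (p * q) * bin (q * r) * bin (r * p) * bin 1) =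
         bin (p * q * r) * bin p * bin q * bin r"
proof -
  have "bin (p * q) * bin (q * r) * bin (r * p) * bin 1 dvd bin (p * q * r) * bin p * bin q * bin r"
    using ternary_quotient_exists[OF assms] by auto
  then show ?thesis
    unfolding ternary_incl_excl_poly_def by (rule dvd_div_mult_self)
qed


section \<open>Coefficients in terms of the numerical semigroup generated by p and q\<close>

text \<open>\<open>p < q\<close> makes \<open>[0, p)\<close> and \<open>[q, p + q)\<close> disjoint,
  and with \<open>2 \<le> p\<close> both fit into one period of length \<open>p q\<close>.\<close>

locale coprime_generators =
  fixes p q :: nat
  assumes p_ge_2: "2 \<le> p" and p_less_q: "p < q" and coprime_p_q: "coprime p q"
begin

lemma p_plus_q_le: "p + q \<le> p * q"
proof -
  have "2 * q \<le> p * q" using p_ge_2 by simp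
  then show ?thesis using p_less_q by linarith
qed

lemma p_plus_q_le_int: "int p + int q \<le> int p * int q"
  using p_plus_q_le by (metis of_nat_add of_nat_le_iff of_nat_mult)

definition chi :: "int \<Rightarrow> int" where
  "chi n = of_bool (\<exists>a b :: nat. n = int (a * p + b * q))"

definition c :: "int \<Rightarrow> int" where
  "c m = chi m - chi (m - 1)"

lemma chi_cases: "chi n = 0 \<or> chi n = 1"
  unfolding chi_def of_bool_eq_0_iff of_bool_eq_1_iff by blast

lemma chi_neg: "n < 0 \<Longrightarrow> chi n = 0"
  by (auto simp: chi_def simp del: of_nat_add of_nat_mult)

lemma chi_0: "chi 0 = 1"
  by (auto simp: chi_def intro: exI[of _ 0])

lemma c_neg: "n < 0 \<Longrightarrow> c n = 0"
  by (simp add: c_def chi_neg)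

lemma c_0: "c 0 = 1"
  by (simp add: c_def chi_neg chi_0)

lemma abs_c_le: "\<bar>c n\<bar> \<le> 1"
  using chi_cases[of n] chi_cases[of "n - 1"] by (auto simp: c_def)

lemma reduced_representation_unique:
  assumes "a < q" "a * p = a' * p + b * q"
  shows "b = 0"
proof -
  have "[a * p = a' * p] (mod q)" using assms(2) by (simp add: cong_def)
  then have "[a = a'] (mod q)"
    using coprime_p_q by (simp add: cong_mult_rcancel_nat coprime_commute)
  moreover have "a' \<le> a"
    using assms(2) p_ge_2 by (metis le_add1 mult_le_cancel2 not_numeral_le_zero zero_less_iff_neq_zero)
  ultimately have "a' = a" using assms(1) by (auto simp: cong_def)
  then show ?thesis using assms p_less_q by simp
qed

text \<open>Each semigroup element is \<open>a p + b q\<close> with \<open>a < q\<close>.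
  Subtracting \<open>q\<close> leaves the semigroup exactly when \<open>b = 0\<close>.\<close>

lemma chi_diff_q: "chi n - chi (n - int q) = of_bool (\<exists>a<q. n = int (a * p))"
proof (cases "\<exists>a b. n = int (a * p + b * q)")
  case False
  then have "chi n = 0" by (simp add: chi_def)
  moreover have "chi (n - int q) = 0"
  proof (rule ccontr)
    assume "\<not> ?thesis"
    then obtain a b where "n - int q = int (a * p + b * q)" by (auto simp: chi_def)
    then have "n = int (a * p + (b + 1) * q)" by (simp add: algebra_simps)
    then show False using False by blast
  qed
  moreover have "\<not> (\<exists>a<q. n = int (a * p))" using False by (metis add_0_right mult_0)
  ultimately show ?thesis by simp
next
  case True
  then obtain a b where ab: "n = int (a * p + b * q)" by blast
  define a' b' where "a' = a mod q" and "b' = b + (a div q) * p"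
  have a': "a' < q" using p_less_q by (simp add: a'_def)
  have "a * p = a' * p + (a div q) * p * q"
    unfolding a'_def using div_mult_mod_eq[of a q] by (metis add.commute distrib_right mult.commute mult.left_commute)
  then have n: "n = int (a' * p + b' * q)" using ab by (simp add: b'_def algebra_simps)
  have 1: "chi n = 1" using True by (simp add: chi_def)
  show ?thesis
  proof (cases "b' = 0")
    case True
    have "chi (n - int q) = 0"
    proof (rule ccontr)
      assume "\<not> ?thesis"
      then obtain x y where "n - int q = int (x * p + y * q)" by (auto simp: chi_def)
      then have "int (a' * p) = int (x * p + (y + 1) * q)" using n True by (simp add: algebra_simps)
      then have "a' * p = x * p + (y + 1) * q" by (simp only: of_nat_eq_iff)
      then show False using reduced_representation_unique[OF a'] by fastforce
    qed
    then show ?thesis using 1 a' n True by auto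
  next
    case False
    then obtain b'' where "b' = Suc b''" by (cases b') auto
    then have "n - int q = int (a' * p + b'' * q)" using n by (simp add: algebra_simps)
    then have "chi (n - int q) = 1" by (auto simp: chi_def)
    moreover have "\<not> (\<exists>a<q. n = int (a * p))"
      using n reduced_representation_unique False by (metis of_nat_eq_iff)
    ultimately show ?thesis using 1 by simp
  qed
qed

text \<open>Otherwise \<open>p q = (a + 1) p + (b + 1) q\<close>; then \<open>q\<close> divides
  \<open>a + 1\<close>, so the first term alone is at least \<open>p q\<close>.\<close>

lemma chi_frobenius: "chi (int (p * q) - int p - int q) = 0"
proof (rule ccontr)
  assume "\<not> ?thesis"
  then obtain a b where "int (p * q) - int p - int q = int (a * p + b * q)"
    by (auto simp: chi_def)
  then have "int (p * q) = int (Suc a * p + Suc b * q)" by (simp add: algebra_simps)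
  then have eq: "p * q = Suc a * p + Suc b * q" by (simp only: of_nat_eq_iff)
  have "q dvd Suc a * p" using eq by (metis dvd_add_left_iff dvd_triv_right)
  then have "q dvd Suc a" using coprime_p_q by (metis coprime_commute coprime_dvd_mult_left_iff)
  then have "q * p \<le> Suc a * p" by (meson dvd_imp_le mult_le_mono1 zero_less_Suc)
  then have "Suc b * q \<le> 0" using eq by (simp add: mult.commute)
  then show False using p_less_q by simp
qed

text \<open>\<open>w\<close> is the periodic coefficient sequence of
  \<open>(1 - z^p) (1 - z^q) / ((1 - z) (1 - z^(p q)))\<close>, extended to all integers.\<close>

definition u :: "int \<Rightarrow> int" where
  "u t = of_bool (t mod (int p * int q) < int p)"

definition w :: "int \<Rightarrow> int" where
  "w t = u t - u (t - int q)"

lemma u_cong: "[s = t] (mod (int p * int q)) \<Longrightarrow> u s = u t"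
  by (simp add: u_def cong_def)

lemma w_cong: "[s = t] (mod (int p * int q)) \<Longrightarrow> w s = w t"
  unfolding w_def by (metis u_cong cong_diff cong_refl)

lemma u_reduced: "0 \<le> t \<Longrightarrow> t < int p * int q \<Longrightarrow> u t = of_bool (t < int p)"
  by (simp add: u_def)

lemma u_neg:
  assumes "- int q \<le> t" "t < 0"
  shows "u t = 0"
proof -
  have "u t = u (t + int p * int q)" by (rule u_cong) (simp add: cong_def)
  also have "\<dots> = 0"
    using u_reduced[of "t + int p * int q"] assms p_plus_q_le_int by auto
  finally show ?thesis .
qed

lemma w_low: "0 \<le> t \<Longrightarrow> t < int p \<Longrightarrow> w t = 1"
  and w_gap: "int p \<le> t \<Longrightarrow> t < int q \<Longrightarrow> w t = 0"
  and w_high: "int q \<le> t \<Longrightarrow> t < int p + int q \<Longrightarrow> w t = - 1"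
  and w_rest: "int p + int q \<le> t \<Longrightarrow> t < int p * int q \<Longrightarrow> w t = 0"
  using u_reduced[of t] u_reduced[of "t - int q"] u_neg[of "t - int q"] p_plus_q_le_int p_less_q
  by (auto simp: w_def)

lemma u_reflect: "u (int p - 1 - t) = u t"
proof -
  define n y where "n = int p * int q" and "y = t mod n"
  have n: "n > 0" "int p \<le> n" using p_ge_2 p_less_q p_plus_q_le_int by (auto simp: n_def)
  have y: "0 \<le> y" "y < n" using n by (auto simp: y_def)
  have ut: "u t = u y" by (rule u_cong) (simp add: cong_def y_def n_def)
  have eq: "[int p - 1 - t = int p - 1 - y] (mod n)"
    unfolding y_def by (intro cong_diff cong_refl) (simp add: cong_def)
  show ?thesis
  proof (cases "y < int p")
    case True
    have "u (int p - 1 - t) = u (int p - 1 - y)" using eq u_cong n_def by blast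
    moreover have "int p - 1 - y < n" using y n by linarith
    ultimately show ?thesis
      using True y ut u_reduced[of y] u_reduced[of "int p - 1 - y"] by (simp add: n_def)
  next
    case False
    have "[int p - 1 - y = int p - 1 - y + n] (mod n)" by (simp add: cong_def)
    then have "u (int p - 1 - t) = u (int p - 1 - y + n)" using eq u_cong n_def cong_trans by blast
    then show ?thesis
      using False y n ut u_reduced[of y] u_reduced[of "int p - 1 - y + n"] by (simp add: n_def)
  qed
qed

text \<open>Modulo \<open>p q\<close> the reflection swaps \<open>[0, p)\<close> and
  \<open>[q, p + q)\<close>, where \<open>w\<close> has opposite signs.\<close>

lemma w_reflect: "w (int p + int q - 1 - t) = - w t"
proof -
  have "u (int p + int q - 1 - t) = u (t - int q)"
    using u_reflect[of "t - int q"] by (simp add: algebra_simps)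
  moreover have "u (int p + int q - 1 - t - int q) = u t"
    using u_reflect[of t] by (simp add: algebra_simps)
  ultimately show ?thesis by (simp add: w_def)
qed

text \<open>All arguments are integers, so that \<open>r\<close> can be replaced by
  \<open>- s\<close> and \<open>t\<close> shifted by periods.\<close>

definition T :: "int \<Rightarrow> int \<Rightarrow> int \<Rightarrow> int" where
  "T r N t = (\<Sum>m=0..N. c m * w (t + r * (N - m)))"

lemma T_neg: "N < 0 \<Longrightarrow> T r N t = 0"
  by (simp add: T_def)

lemma T_rec: "T r N t = T r (N - 1) (t + r) + c N * w t"
proof (cases "N \<ge> 0")
  case True
  then have "{0..N} = insert N {0..N - 1}" by auto
  then have "T r N t = c N * w t + (\<Sum>m=0..N - 1. c m * w (t + r * (N - m)))"
    by (simp add: T_def)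
  also have "(\<Sum>m=0..N - 1. c m * w (t + r * (N - m))) = T r (N - 1) (t + r)"
    unfolding T_def by (intro sum.cong) (auto simp: algebra_simps)
  finally show ?thesis by simp
qed (simp add: T_neg c_neg)

lemma T_cong:
  assumes "[r = r'] (mod (int p * int q))" "[t = t'] (mod (int p * int q))"
  shows "T r N t = T r' N t'"
  unfolding T_def using assms
  by (intro sum.cong refl arg_cong2[where f = "(*)"] w_cong cong_add cong_mult cong_refl) auto

lemma T_uminus: "T (- r) N t = - T r N (int p + int q - 1 - t)"
proof -
  have "w (t + - r * (N - m)) = - w (int p + int q - 1 - t + r * (N - m))" for m
    using w_reflect[of "int p + int q - 1 - t + r * (N - m)"] by (simp add: algebra_simps)
  then show ?thesis by (simp add: T_def sum_negf)
qed

section \<open>Generating functions\<close>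

unbundle fps_syntax

abbreviation fbin :: "nat \<Rightarrow> int fps" where
  "fbin n \<equiv> fps_X ^ n - 1"

definition Q :: "int fps" where
  "Q = Abs_fps (\<lambda>n. c (int n))"

definition E :: "int fps" where
  "E = Abs_fps (\<lambda>n. w (int n))"

lemma fbin_mult_nth: "(fbin k * f) $ n = (if n < k then 0 else f $ (n - k)) - f $ n"
  by (simp add: left_diff_distrib fps_X_power_mult_nth)

text \<open>With \<open>C\<close> the generating series of the semigroup,
  \<open>Q = (1 - z) C\<close>. By \<open>chi_diff_q\<close>, \<open>(1 - z^q) C\<close> is the
  geometric sum \<open>S\<close> in \<open>z^p\<close>, and
  \<open>(z^p - 1) S = z^(p q) - 1\<close>.\<close>

lemma Q_mult: "Q * fbin p * fbin q = fbin (p * q) * fbin 1"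
proof -
  define C where "C = Abs_fps (\<lambda>n. chi (int n))"
  define S :: "int fps" where "S = (\<Sum>a<q. (fps_X ^ p) ^ a)"
  have "Q = - (fbin 1 * C)"
  proof (rule fps_ext)
    fix n show "Q $ n = (- (fbin 1 * C)) $ n"
      unfolding fps_neg_nth fbin_mult_nth by (cases n) (simp_all add: Q_def C_def c_def chi_neg)
  qed
  moreover have "fbin q * C = - (\<Sum>a<q. (fps_X ^ p) ^ a)"
  proof (rule fps_ext)
    fix n
    have "(fbin q * C) $ n = - (chi (int n) - chi (int n - int q))"
      by (simp add: fbin_mult_nth C_def chi_neg of_nat_diff)
    also have "\<dots> = - of_bool (\<exists>a<q. n = a * p)"
      unfolding chi_diff_q by (simp only: of_nat_eq_iff)
    also have "of_bool (\<exists>a<q. n = a * p) = (\<Sum>a<q. of_bool (n = a * p) :: int)"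
    proof (cases "\<exists>a<q. n = a * p")
      case True
      then obtain a where a: "a < q" "n = a * p" by blast
      have "(\<Sum>a<q. of_bool (n = a * p)) = (\<Sum>b<q. if b = a then 1 else 0 :: int)"
        using a p_ge_2 by (intro sum.cong) auto
      then have "(\<Sum>a<q. of_bool (n = a * p)) = (1 :: int)" using a(1) by simp
      with True show ?thesis by (simp only: of_bool_eq)
    qed (simp add: sum.neutral)
    also have "- (\<Sum>a<q. of_bool (n = a * p)) = (- (\<Sum>a<q. (fps_X ^ p) ^ a) :: int fps) $ n"
      unfolding power_mult[symmetric]
      by (simp add: fps_sum_nth fps_X_power_iff mult.commute of_bool_def)
    finally show "(fbin q * C) $ n = (- (\<Sum>a<q. (fps_X ^ p) ^ a) :: int fps) $ n" .
  qed
  moreover have "fbin p * (\<Sum>a<q. (fps_X ^ p) ^ a) = fbin (p * q)"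
    by (simp only: power_diff_1_eq[symmetric] power_mult)
  ultimately have Q: "Q = - (fbin 1 * C)" and C: "fbin q * C = - S" and S: "fbin p * S = fbin (p * q)"
    unfolding S_def by blast+
  have "Q * fbin p * fbin q = - (fbin 1 * (fbin p * (fbin q * C)))"
    unfolding Q by (simp only: mult_minus_left mult_minus_right ac_simps)
  also have "\<dots> = (fbin p * S) * fbin 1"
    unfolding C by (simp only: mult_minus_left mult_minus_right minus_minus ac_simps)
  finally show ?thesis unfolding S .
qed

text \<open>\<open>U\<close>, the generating series of \<open>u\<close>, is the geometric sum
  \<open>S\<close> repeated with period \<open>p q\<close>, and
  \<open>E = (1 - z^q) U\<close>.\<close>

lemma E_mult: "E * fbin (p * q) * fbin 1 = fbin p * fbin q"
proof -
  define U where "U = Abs_fps (\<lambda>n. u (int n))"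
  define S :: "int fps" where "S = (\<Sum>i<p. fps_X ^ i)"
  have "E = - (fbin q * U)"
  proof (rule fps_ext)
    fix n show "E $ n = (- (fbin q * U)) $ n"
      by (simp add: E_def U_def w_def fbin_mult_nth u_neg of_nat_diff)
  qed
  moreover have "fbin (p * q) * U = - (\<Sum>i<p. fps_X ^ i)"
  proof (rule fps_ext)
    fix n
    have "(fbin (p * q) * U) $ n = - of_bool (n < p)"
    proof (cases "n < p * q")
      case True
      then have "int n < int p * int q" by (metis of_nat_less_iff of_nat_mult)
      then show ?thesis using True by (simp add: fbin_mult_nth U_def u_reduced)
    next
      case False
      then have "u (int (n - p * q)) = u (int n)"
        by (intro u_cong) (simp add: cong_iff_lin)
      then show ?thesis using False p_plus_q_le by (simp add: fbin_mult_nth U_def)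
    qed
    also have "\<dots> = (- (\<Sum>i<p. fps_X ^ i) :: int fps) $ n"
      by (simp add: fps_sum_nth fps_X_power_iff)
    finally show "(fbin (p * q) * U) $ n = (- (\<Sum>i<p. fps_X ^ i) :: int fps) $ n" .
  qed
  moreover have "fbin 1 * (\<Sum>i<p. fps_X ^ i) = fbin p"
    by (simp only: power_diff_1_eq power_one_right)
  ultimately have E: "E = - (fbin q * U)" and U: "fbin (p * q) * U = - S" and S: "fbin 1 * S = fbin p"
    unfolding S_def by blast+
  have "E * fbin (p * q) * fbin 1 = - (fbin q * (fbin 1 * (fbin (p * q) * U)))"
    unfolding E by (simp only: mult_minus_left mult_minus_right ac_simps)
  also have "\<dots> = (fbin 1 * S) * fbin q"
    unfolding U by (simp only: mult_minus_left mult_minus_right minus_minus ac_simps)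
  finally show ?thesis unfolding S .
qed


lemma fbin_neq_0: "n > 0 \<Longrightarrow> fbin n \<noteq> 0"
proof -
  assume "n > 0"
  then have "fbin n $ n \<noteq> 0 $ n" by (simp add: fps_X_power_iff)
  then show ?thesis by metis
qed

lemma fbin_compose: "r > 0 \<Longrightarrow> fbin n oo fps_X ^ r = fbin (r * n)"
  by (simp add: fps_compose_sub_distrib fps_X_power_compose power_mult)

lemma Q_compose_mult:
  assumes "r > 0"
  shows "(Q oo fps_X ^ r) * fbin (r * p) * fbin (r * q) = fbin (r * (p * q)) * fbin r"
proof -
  have "(Q * fbin p * fbin q) oo fps_X ^ r = (fbin (p * q) * fbin 1) oo fps_X ^ r"
    by (simp only: Q_mult)
  moreover have "(fps_X ^ r :: int fps) $ 0 = 0" using assms by simp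
  ultimately show ?thesis
    by (simp only: fps_compose_mult_distrib fbin_compose[OF assms] mult_1_right)
qed

text \<open>In the convolution only indices \<open>i = r m\<close> contribute; with
  \<open>n = r N + t\<close> the other index is \<open>n - i = t + r (N - m)\<close>.\<close>

lemma nth_Q_compose_mult_E:
  assumes "r > 0"
  shows "((Q oo fps_X ^ r) * E) $ n = T (int r) (int (n div r)) (int (n mod r))"
proof -
  have Qr: "(Q oo fps_X ^ r) $ k = (if r dvd k then c (int (k div r)) else 0)" for k
  proof -
    have "(Q oo fps_X ^ r) $ k = (\<Sum>i=0..k. if r * i = k then c (int i) else 0)"
      unfolding fps_compose_nth power_mult[symmetric]
      by (intro sum.cong) (auto simp: Q_def fps_X_power_iff)
    also have "\<dots> = (if r dvd k then c (int (k div r)) else 0)"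
    proof (cases "r dvd k")
      case True
      then obtain j where j: "k = r * j" by (elim dvdE)
      have "(\<Sum>i=0..k. if r * i = k then c (int i) else 0) = (\<Sum>i=0..k. if i = j then c (int i) else 0)"
        using assms by (intro sum.cong) (auto simp: j)
      also have "\<dots> = c (int j)" using assms by (auto simp: j)
      finally show ?thesis using assms by (simp add: j)
    qed (auto intro!: sum.neutral)
    finally show ?thesis .
  qed
  have "((Q oo fps_X ^ r) * E) $ n = (\<Sum>i\<in>{0..n}. if r dvd i then c (int (i div r)) * w (int (n - i)) else 0)"
    unfolding fps_mult_nth by (intro sum.cong) (auto simp: Qr E_def)
  also have "\<dots> = (\<Sum>i\<in>{i\<in>{0..n}. r dvd i}. c (int (i div r)) * w (int (n - i)))"
    by (rule sum.inter_filter[symmetric]) simp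
  also have "\<dots> = (\<Sum>m\<in>{0..int (n div r)}. c m * w (int (n mod r) + int r * (int (n div r) - m)))"
  proof (rule sum.reindex_bij_witness[of _ "\<lambda>m. r * nat m" "\<lambda>i. int (i div r)"])
    fix i assume i: "i \<in> {i\<in>{0..n}. r dvd i}"
    then have le: "i div r \<le> n div r" by (simp add: div_le_mono)
    have "n - i = n mod r + r * (n div r - i div r)"
    proof -
      have "r * (n div r - i div r) = r * (n div r) - i" using i by (simp add: right_diff_distrib')
      moreover have "i \<le> r * (n div r)" using i le by (metis dvd_mult_div_cancel mem_Collect_eq mult_le_mono2)
      ultimately show ?thesis using mult_div_mod_eq[of r n] by linarith
    qed
    then show "c (int (i div r)) * w (int (n mod r) + int r * (int (n div r) - int (i div r))) =
        c (int (i div r)) * w (int (n - i))"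
      using le by (simp add: of_nat_diff)
    show "int (i div r) \<in> {0..int (n div r)}" using le by simp
    show "r * nat (int (i div r)) = i" using i by simp
  next
    fix m assume m: "m \<in> {0..int (n div r)}"
    then have "nat m \<le> n div r" by auto
    then have "r * nat m \<le> r * (n div r)" by simp
    then have "r * nat m \<le> n" using times_div_less_eq_dividend order_trans by blast
    then show "r * nat m \<in> {i\<in>{0..n}. r dvd i}" by simp
    show "int (r * nat m div r) = m" using m assms by simp
  qed
  finally show ?thesis by (simp only: T_def)
qed

lemma fps_of_poly_ternary_incl_excl_poly:
  assumes "coprime q r" "coprime p r" "r > 0"
  shows "fps_of_poly (ternary_incl_excl_poly p q r) = (Q oo fps_X ^ r) * E"
proof -
  define D where "D = fbin (p * q) * fbin (q * r) * fbin (r * p) * fbin 1"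
  have pos: "p > 0" "q > 0" using p_ge_2 p_less_q by auto
  have fb: "fps_of_poly (bin n) = fbin n" for n
    by (simp add: fps_of_poly_diff fps_of_poly_monom')
  have "fps_of_poly (ternary_incl_excl_poly p q r) * D = fbin (p * q * r) * fbin p * fbin q * fbin r"
    using arg_cong[OF ternary_incl_excl_poly_mult[OF coprime_p_q assms(1,2) pos assms(3)],
        where f = fps_of_poly]
    by (simp only: D_def fps_of_poly_mult fb)
  also have "\<dots> = (fbin (r * (p * q)) * fbin r) * (fbin p * fbin q)"
    by (simp only: ac_simps)
  also have "\<dots> = ((Q oo fps_X ^ r) * E) * D"
    unfolding Q_compose_mult[OF assms(3), symmetric] E_mult[symmetric] D_def
    by (simp only: ac_simps)
  finally have "fps_of_poly (ternary_incl_excl_poly p q r) * D = ((Q oo fps_X ^ r) * E) * D" .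
  moreover have "D \<noteq> 0" unfolding D_def using pos assms(3) by (intro no_zero_divisors fbin_neq_0) auto
  ultimately show ?thesis by simp
qed

section \<open>Height as a bound on \<open>T\<close>\<close>

text \<open>The pairs with \<open>N \<ge> 0\<close> and \<open>0 \<le> t < r\<close> index each
  coefficient of the ternary polynomial exactly once.\<close>

definition bounded :: "nat \<Rightarrow> int \<Rightarrow> bool" where
  "bounded r X \<longleftrightarrow> (\<forall>N t. 0 \<le> t \<longrightarrow> t < int r \<longrightarrow> \<bar>T (int r) N t\<bar> \<le> X)"

lemma height_le_iff:
  assumes "0 \<le> X"
  shows "height f \<le> X \<longleftrightarrow> (\<forall>n. \<bar>coeff f n\<bar> \<le> X)"
proof -
  have "\<bar>coeff f n\<bar> \<le> X" if "n \<notin> {..degree f}" for n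
    using that assms by (simp add: coeff_eq_0)
  then have "(\<forall>n. \<bar>coeff f n\<bar> \<le> X) \<longleftrightarrow> (\<forall>n\<in>{..degree f}. \<bar>coeff f n\<bar> \<le> X)" by blast
  then show ?thesis unfolding height_def by simp
qed

lemma height_nonneg: "0 \<le> height f"
  unfolding height_def by (rule order_trans[OF abs_ge_zero Max_ge]) auto

lemma bounded_iff:
  assumes "r > 0" "0 \<le> X"
  shows "bounded r X \<longleftrightarrow> (\<forall>n. \<bar>((Q oo fps_X ^ r) * E) $ n\<bar> \<le> X)"
proof
  assume "bounded r X"
  then show "\<forall>n. \<bar>((Q oo fps_X ^ r) * E) $ n\<bar> \<le> X"
    unfolding nth_Q_compose_mult_E[OF assms(1)] bounded_def using assms(1) by simp
next
  assume *: "\<forall>n. \<bar>((Q oo fps_X ^ r) * E) $ n\<bar> \<le> X"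
  show "bounded r X"
    unfolding bounded_def
  proof (intro allI impI)
    fix N t :: int assume t: "0 \<le> t" "t < int r"
    show "\<bar>T (int r) N t\<bar> \<le> X"
    proof (cases "N < 0")
      case False
      have "nat t < r" using t by simp
      then have "(r * nat N + nat t) div r = nat N" "(r * nat N + nat t) mod r = nat t"
        using assms(1) by simp_all
      then show ?thesis
        using *[rule_format, of "r * nat N + nat t"] t False
        unfolding nth_Q_compose_mult_E[OF assms(1)] by simp
    qed (simp add: T_neg assms)
  qed
qed

lemma height_ternary_le_iff:
  assumes "coprime q r" "coprime p r" "r > 0" "0 \<le> X"
  shows "height (ternary_incl_excl_poly p q r) \<le> X \<longleftrightarrow> bounded r X"
  unfolding height_le_iff[OF assms(4)] bounded_iff[OF assms(3,4)]
    fps_of_poly_ternary_incl_excl_poly[OF assms(1-3), symmetric] by simp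

section \<open>Coefficients for \<open>r = 1\<close> and \<open>r = 2\<close>\<close>

lemma Q_mult_E: "Q * E = 1"
proof -
  define D where "D = fbin p * fbin q * (fbin (p * q) * fbin 1)"
  have "Q * E * D = (Q * fbin p * fbin q) * (E * fbin (p * q) * fbin 1)"
    unfolding D_def by (simp only: ac_simps)
  also have "\<dots> = 1 * D"
    unfolding Q_mult E_mult D_def by (simp only: ac_simps mult_1_left)
  finally have "Q * E * D = 1 * D" .
  moreover have "D \<noteq> 0"
    unfolding D_def using p_ge_2 p_less_q by (intro no_zero_divisors fbin_neq_0) auto
  ultimately show ?thesis by simp
qed

lemma T_1_0: "T 1 N 0 = of_bool (N = 0)"
proof (cases "N < 0")
  case False
  then obtain n where n: "N = int n" using zero_le_imp_eq_int[of N] by auto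
  show ?thesis
    using nth_Q_compose_mult_E[of 1 n] by (simp add: Q_mult_E n split: if_splits)
qed (auto simp: T_neg)

text \<open>For odd \<open>p\<close> and \<open>q\<close>, \<open>Q(z^2) = Q(z) Q(-z)\<close>. So
  \<open>Q(z^2) / Q(z) = Q(-z)\<close>, whose coefficients are those of \<open>Q\<close> up to
  sign.\<close>

lemma bounded_2:
  assumes "odd p" "odd q"
  shows "bounded 2 1"
proof -
  define R where "R = Q oo (fps_const (- 1) * fps_X)"
  have X0: "(fps_const (- 1) * fps_X :: int fps) $ 0 = 0" by simp
  have odd_c: "fbin n oo (fps_const (- 1) * fps_X) = - (fps_X ^ n + 1)" if "odd n" for n
  proof -
    have "fbin n oo (fps_const (- 1) * fps_X) = (- fps_X) ^ n - 1"
      by (simp add: fps_compose_sub_distrib fps_X_power_compose fps_const_neg[symmetric] del: fps_const_neg)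
    then show ?thesis using that by simp
  qed
  have "(Q * fbin p * fbin q) oo (fps_const (- 1) * fps_X) = (fbin (p * q) * fbin 1) oo (fps_const (- 1) * fps_X)"
    by (simp only: Q_mult)
  moreover have "odd (p * q)" using assms by simp
  ultimately have "R * (- (fps_X ^ p + 1)) * (- (fps_X ^ q + 1)) = (- (fps_X ^ (p * q) + 1)) * (- (fps_X ^ 1 + 1))"
    unfolding fps_compose_mult_distrib[OF X0] R_def[symmetric]
    by (simp only: odd_c[OF assms(1)] odd_c[OF assms(2)] odd_c[of "p * q"] odd_c[OF odd_one]
      not_False_eq_True)
  then have R: "R * (fps_X ^ p + 1) * (fps_X ^ q + 1) = (fps_X ^ (p * q) + 1) * (fps_X ^ 1 + 1)"
    by (simp only: mult_minus_left mult_minus_right minus_minus)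
  \<comment> \<open>Each factor of \<open>Q(z^2)\<close> splits into one for \<open>Q(z)\<close> and
    one for \<open>R\<close>, which is \<open>Q(-z)\<close>.\<close>
  have sq: "fbin (2 * n) = fbin n * (fps_X ^ n + 1)" for n
    by (simp add: algebra_simps power_add[symmetric] mult_2)
  have "(Q oo fps_X ^ 2) * (fbin (2 * p) * fbin (2 * q)) = fbin (2 * (p * q)) * fbin (2 * 1)"
    using Q_compose_mult[of 2] by (simp add: mult.assoc)
  also have "\<dots> = (fbin (p * q) * fbin 1) * ((fps_X ^ (p * q) + 1) * (fps_X ^ 1 + 1))"
    unfolding sq by (simp only: ac_simps)
  also have "\<dots> = Q * R * (fbin (2 * p) * fbin (2 * q))"
    unfolding Q_mult[symmetric] R[symmetric] sq by (simp only: ac_simps)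
  finally have "(Q oo fps_X ^ 2) * (fbin (2 * p) * fbin (2 * q)) = Q * R * (fbin (2 * p) * fbin (2 * q))" .
  moreover have "fbin (2 * p) * fbin (2 * q) \<noteq> 0"
    using p_ge_2 p_less_q by (intro no_zero_divisors fbin_neq_0) auto
  ultimately have "Q oo fps_X ^ 2 = Q * R"
    by (simp only: mult_cancel_right) simp
  then have "(Q oo fps_X ^ 2) * E = R"
    using Q_mult_E by (simp add: ac_simps)
  moreover have "\<bar>R $ n\<bar> \<le> 1" for n
    unfolding R_def fps_compose_linear by (simp add: Q_def abs_mult power_abs abs_c_le)
  ultimately show ?thesis by (simp add: bounded_iff)
qed


section \<open>Bounds on T\<close>

lemma T_periodic: "T r N (t - int p * int q) = T r N t"
  by (rule T_cong) (simp_all add: cong_def)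

lemma T_bounded_of_reduced:
  assumes "\<And>t. 0 \<le> t \<Longrightarrow> t < int p * int q \<Longrightarrow> \<bar>T r N t\<bar> \<le> X"
  shows "\<bar>T r N t\<bar> \<le> X"
proof -
  have n: "int p * int q > 0" using p_ge_2 p_less_q by simp
  have "T r N t = T r N (t mod (int p * int q))"
    by (rule T_cong) (simp_all add: cong_def)
  then show ?thesis using assms[of "t mod (int p * int q)"] n by simp
qed

text \<open>\<open>w\<close> vanishes on \<open>[p + q, p q)\<close>, so steps up by
  \<open>r\<close> keep the value until \<open>t\<close> enters \<open>[p q, p q + r)\<close>, one
  period above \<open>[0, r)\<close>.\<close>

lemma T_high:
  assumes "bounded r X" "r > 0" "int p + int q \<le> t" "t < int p * int q + int r"
  shows "\<bar>T (int r) N t\<bar> \<le> X"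
  using assms(3,4)
proof (induction "nat (int p * int q + int r - t)" arbitrary: t N rule: less_induct)
  case less
  show ?case
  proof (cases "t \<ge> int p * int q")
    case True
    then have "\<bar>T (int r) N (t - int p * int q)\<bar> \<le> X"
      using assms(1) less.prems by (simp add: bounded_def)
    then show ?thesis by (simp only: T_periodic)
  next
    case False
    then have "\<bar>T (int r) (N - 1) (t + int r)\<bar> \<le> X"
      using less.prems assms(2) by (intro less.hyps) auto
    then show ?thesis using T_rec[of "int r" N t] w_rest[of t] less.prems False by simp
  qed
qed

text \<open>For \<open>r \<le> t < p + q\<close> the value \<open>T r N t\<close> lies between the values reached by one step
  up and one step down, because consecutive values of \<open>c\<close> never have the same nonzero sign.\<close>

lemma bounded_imp_T_bounded:
  assumes "bounded r X" "r > q"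
  shows "\<bar>T (int r) N t\<bar> \<le> X"
proof (rule T_bounded_of_reduced)
  fix t assume t: "0 \<le> t" "t < int p * int q"
  show "\<bar>T (int r) N t\<bar> \<le> X"
  proof (cases "t < int r \<or> int p + int q \<le> t")
    case True
    then show ?thesis
      using t assms T_high[of r X t N] by (auto simp: bounded_def)
  next
    case False
    \<comment> \<open>Here \<open>q < r \<le> t < p + q\<close>, so \<open>t\<close> is in the upper
      interval and \<open>t - r\<close> in \<open>[0, p)\<close>.\<close>
    have w: "w t = - 1" "w (t - int r) = 1"
      using False t p_less_q assms(2) by (auto intro!: w_high w_low)
    have "\<bar>T (int r) (N - 1) (t + int r)\<bar> \<le> X"
      using False t assms p_less_q by (intro T_high) auto
    then have up: "\<bar>T (int r) N t + c N\<bar> \<le> X"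
      using T_rec[of "int r" N t] w by simp
    have "\<bar>T (int r) (N + 1) (t - int r)\<bar> \<le> X"
      using assms False p_less_q by (simp add: bounded_def)
    then have down: "\<bar>T (int r) N t + c (N + 1)\<bar> \<le> X"
      using T_rec[of "int r" "N + 1" "t - int r"] w by simp
    show ?thesis
      using up down chi_cases[of N] chi_cases[of "N + 1"] chi_cases[of "N - 1"]
      by (auto simp: c_def)
  qed
qed

text \<open>Stepping by \<open>s\<close> through one of the two intervals where \<open>w\<close> is nonzero accumulates a
  sum of consecutive values of \<open>c\<close>, which telescopes to a difference of two values of \<open>chi\<close>.\<close>

lemma T_upper_block:
  assumes "bounded s X" "s > 0" "int q \<le> t" "t < int p * int q + int s"
  shows "\<exists>e\<in>{0, 1}. \<bar>T (int s) N t + chi N - e\<bar> \<le> X"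
  using assms(3,4)
proof (induction "nat (int p * int q + int s - t)" arbitrary: t N rule: less_induct)
  case less
  show ?case
  proof (cases "t \<ge> int p + int q")
    case True
    then have "\<bar>T (int s) N t\<bar> \<le> X" using less.prems assms by (intro T_high) auto
    \<comment> \<open>\<open>e\<close> is the value of \<open>chi\<close> at the index where the
      path leaves the block.\<close>
    then show ?thesis using chi_cases[of N] by (intro bexI[of _ "chi N"]) auto
  next
    case False
    have "\<exists>e\<in>{0, 1}. \<bar>T (int s) (N - 1) (t + int s) + chi (N - 1) - e\<bar> \<le> X"
      using less.prems False assms(2) p_plus_q_le_int by (intro less.hyps) auto
    \<comment> \<open>As \<open>w t = - 1\<close>, the term \<open>- c N\<close> is cancelled by the
      change of \<open>chi\<close>, so \<open>T + chi\<close> is constant along the path.\<close>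
    moreover have "T (int s) N t + chi N = T (int s) (N - 1) (t + int s) + chi (N - 1)"
      using T_rec[of "int s" N t] w_high[of t] less.prems False by (simp add: c_def)
    ultimately show ?thesis by simp
  qed
qed

text \<open>\<open>w\<close> vanishes on \<open>[p, q)\<close>, so steps up by \<open>s\<close> keep
  the value until \<open>t\<close> lands in \<open>[q, q + s)\<close>.\<close>

lemma T_gap:
  assumes "\<And>N t. int q \<le> t \<Longrightarrow> t < int q + int s \<Longrightarrow> \<bar>T (int s) N t\<bar> \<le> Y"
    and "s > 0" "int p \<le> t" "t < int q + int s"
  shows "\<bar>T (int s) N t\<bar> \<le> Y"
  using assms(3,4)
proof (induction "nat (int q + int s - t)" arbitrary: t N rule: less_induct)
  case less
  show ?case
  proof (cases "t \<ge> int q")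
    case False
    then have "\<bar>T (int s) (N - 1) (t + int s)\<bar> \<le> Y"
      using less.prems assms(2) by (intro less.hyps) auto
    then show ?thesis using T_rec[of "int s" N t] w_gap[of t] less.prems False by simp
  qed (use assms less.prems in auto)
qed

text \<open>The path descends by \<open>s\<close> into \<open>[0, s)\<close>. Here
  \<open>w = 1\<close>, so \<open>T - chi\<close> is the invariant, and \<open>e\<close> is
  \<open>chi\<close> at the end of the path.\<close>

lemma T_lower_block:
  assumes "bounded s X" "s > 0" "0 \<le> t" "t < int p"
  shows "\<exists>e\<in>{0, 1}. \<bar>T (int s) N t - chi N + e\<bar> \<le> X"
  using assms(3,4)
proof (induction "nat t" arbitrary: t N rule: less_induct)
  case less
  show ?case
  proof (cases "t < int s")
    case True
    then have "\<bar>T (int s) N t\<bar> \<le> X" using less.prems assms by (simp add: bounded_def)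
    then show ?thesis using chi_cases[of N] by (intro bexI[of _ "chi N"]) auto
  next
    case False
    have "\<exists>e\<in>{0, 1}. \<bar>T (int s) (N + 1) (t - int s) - chi (N + 1) + e\<bar> \<le> X"
      using less.prems False assms(2) by (intro less.hyps) auto
    moreover have "T (int s) N t - chi N = T (int s) (N + 1) (t - int s) - chi (N + 1)"
      using T_rec[of "int s" "N + 1" "t - int s"] w_low[of "t - int s"] less.prems False assms(2)
      by (simp add: c_def)
    ultimately show ?thesis by simp
  qed
qed

text \<open>Going down from \<open>[0, p)\<close> and up from everywhere else, the path crosses at
  most one block, at a cost of \<open>\<bar>chi N - e\<bar> \<le> 1\<close>.\<close>

lemma bounded_imp_T_bounded_Suc:
  assumes "bounded s X" "s > 0"
  shows "\<bar>T (int s) N t\<bar> \<le> X + 1"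
proof (rule T_bounded_of_reduced)
  fix t assume t: "0 \<le> t" "t < int p * int q"
  have upper: "\<bar>T (int s) N t\<bar> \<le> X + 1" if "int q \<le> t" "t < int p * int q + int s" for N t
    using T_upper_block[OF assms that, of N] chi_cases[of N] by auto
  have "int q \<le> int p * int q" using p_plus_q_le_int by linarith
  then have gap: "\<bar>T (int s) N t\<bar> \<le> X + 1" if "int p \<le> t" "t < int q + int s"
    using T_gap[of s "X + 1" t N] upper that assms(2) by auto
  show "\<bar>T (int s) N t\<bar> \<le> X + 1"
  proof (cases "t < int p")
    case True
    show ?thesis using T_lower_block[OF assms t(1) True, of N] chi_cases[of N] by auto
  next
    case False
    then show ?thesis using gap upper[of t N] t assms(2) by (cases "t < int q") auto
  qed
qed

section \<open>Exact values for \<open>s = 1\<close>\<close>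

text \<open>Steps of 1 keep \<open>N + t\<close> fixed and lead to \<open>t = p q\<close>, one
  period above \<open>t = 0\<close>, where \<open>T_1_0\<close> applies.\<close>

lemma T_1_high:
  assumes "int p + int q \<le> t" "t \<le> int p * int q"
  shows "T 1 N t = of_bool (N + t = int p * int q)"
  using assms
proof (induction "nat (int p * int q - t)" arbitrary: t N rule: less_induct)
  case less
  show ?case
  proof (cases "t = int p * int q")
    case True
    then show ?thesis using T_periodic[of 1 N t] T_1_0[of N] by simp
  next
    case False
    then have "T 1 (N - 1) (t + 1) = of_bool (N - 1 + (t + 1) = int p * int q)"
      using less.prems by (intro less.hyps) auto
    then show ?thesis using T_rec[of 1 N t] w_rest[of t] less.prems False by simp
  qed
qed

lemma T_1_upper_block:
  assumes "int q \<le> t" "t \<le> int p + int q"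
  shows "T 1 N t = of_bool (N + t = int p * int q) + chi (N + t - int p - int q) - chi N"
  using assms
proof (induction "nat (int p + int q - t)" arbitrary: t N rule: less_induct)
  case less
  show ?case
  proof (cases "t = int p + int q")
    case True
    then show ?thesis using T_1_high[of t N] p_plus_q_le_int by simp
  next
    case False
    then have "T 1 (N - 1) (t + 1) = of_bool (N - 1 + (t + 1) = int p * int q)
        + chi (N - 1 + (t + 1) - int p - int q) - chi (N - 1)"
      using less.prems by (intro less.hyps) auto
    then show ?thesis
      using T_rec[of 1 N t] w_high[of t] less.prems False by (simp add: c_def)
  qed
qed

lemma T_1_lower_block:
  assumes "0 \<le> t" "t < int p"
  shows "T 1 N t = of_bool (N + t = 0) - chi (N + t) + chi N"
  using assms
proof (induction "nat t" arbitrary: t N rule: less_induct)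
  case less
  show ?case
  proof (cases "t = 0")
    case False
    then have "T 1 (N + 1) (t - 1) = of_bool (N + 1 + (t - 1) = 0) - chi (N + 1 + (t - 1)) + chi (N + 1)"
      using less.prems by (intro less.hyps) auto
    then show ?thesis
      using T_rec[of 1 "N + 1" "t - 1"] w_low[of "t - 1"] less.prems False by (simp add: c_def)
  qed (simp add: T_1_0)
qed

text \<open>The quotient for \<open>s = 1\<close> has height 1, so
  \<open>bounded_imp_T_bounded_Suc\<close> would give only 2, while the convention
  \<open>A p q 1 = 0\<close> calls for 1. Hence the exact values.\<close>

lemma T_1_bounded: "\<bar>T 1 N t\<bar> \<le> 1"
proof (rule T_bounded_of_reduced)
  fix t assume t: "0 \<le> t" "t < int p * int q"
  \<comment> \<open>If \<open>N + t = p q\<close>, the positive \<open>chi\<close> term sits at the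
    Frobenius number and vanishes, so it does not add to the extra 1.\<close>
  have upper: "\<bar>T 1 N t\<bar> \<le> 1" if "int q \<le> t" "t \<le> int p + int q" for N t
    using T_1_upper_block[OF that, of N] chi_frobenius chi_cases[of N]
      chi_cases[of "N + t - int p - int q"] by (cases "N + t = int p * int q") auto
  consider "t < int p" | "int p \<le> t" "t < int q" | "int q \<le> t" "t \<le> int p + int q" | "int p + int q \<le> t"
    by linarith
  then show "\<bar>T 1 N t\<bar> \<le> 1"
  proof cases
    case 1
    \<comment> \<open>If \<open>N + t = 0\<close>, the extra 1 cancels \<open>chi 0\<close>.\<close>
    then show ?thesis
      using T_1_lower_block[of t N] t chi_cases[of N] chi_cases[of "N + t"] chi_0 chi_neg[of N]
      by (cases "N + t = 0"; cases "N < 0") auto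
  next
    case 2
    then show ?thesis using T_gap[of 1 1 t N] upper p_ge_2 by auto
  next
    case 3
    then show ?thesis by (rule upper)
  next
    case 4
    then show ?thesis using T_1_high[of t N] t by simp
  qed
qed

section \<open>Comparison of \<open>r\<close> and \<open>s\<close>\<close>

text \<open>When \<open>r\<close> is congruent to \<open>- s\<close>, the values correspond under
  \<open>p + q - 1 - t\<close>, a permutation of all integers; this is why \<open>t\<close> is
  unrestricted.\<close>

lemma T_bounded_cong:
  assumes "[int r = int s] (mod int (p * q)) \<or> [int r = - int s] (mod int (p * q))"
  shows "(\<forall>N t. \<bar>T (int r) N t\<bar> \<le> X) \<longleftrightarrow> (\<forall>N t. \<bar>T (int s) N t\<bar> \<le> X)"
  using assms
proof
  assume "[int r = int s] (mod int (p * q))"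
  then have "T (int r) N t = T (int s) N t" for N t by (intro T_cong) auto
  then show ?thesis by simp
next
  assume "[int r = - int s] (mod int (p * q))"
  then have *: "T (int r) N t = - T (int s) N (int p + int q - 1 - t)" for N t
    unfolding T_uminus[symmetric] by (intro T_cong) auto
  have "\<bar>T (int s) N t\<bar> = \<bar>T (int r) N (int p + int q - 1 - t)\<bar>" for N t
    using *[of N "int p + int q - 1 - t"] by simp
  with * show ?thesis by (metis abs_minus_cancel)
qed

lemma A_bounds:
  assumes "coprime q r" "coprime p r" "r > q" "s \<ge> 1" "r \<ge> 3"
    and cong: "[int r = int s] (mod int (p * q)) \<or> [int r = - int s] (mod int (p * q))"
  shows "A p q s \<le> A p q r \<and> A p q r \<le> A p q s + 1"
proof -
  \<comment> \<open>Applied to \<open>p\<close> and \<open>q\<close>: coprimality passes from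
    \<open>r\<close> to \<open>s\<close> through the congruence.\<close>
  have gcd_s: "coprime a s" if "a dvd p * q" "coprime a r" for a
  proof -
    have "int a dvd int (p * q)" using that(1) by (simp only: int_dvd_int_iff)
    then have "[int r = int s] (mod int a) \<or> [int r = - int s] (mod int a)"
      using cong cong_dvd_modulus by blast
    moreover have "coprime (int r) (int a)" using that(2) by (simp add: coprime_commute)
    ultimately have "coprime (int s) (int a)" by (metis cong_imp_coprime coprime_minus_left_iff)
    then show ?thesis by (simp add: coprime_commute)
  qed
  have cs: "coprime q s" "coprime p s" using gcd_s assms by simp_all
  have Ar: "A p q r = height (ternary_incl_excl_poly p q r)" using assms by (simp add: A_def)
  \<comment> \<open>As \<open>r > q\<close>, the height for \<open>r\<close> is the bound over all
    \<open>t\<close>, which can be evaluated with \<open>s\<close> instead.\<close>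
  have r_iff: "A p q r \<le> X \<longleftrightarrow> (\<forall>N t. \<bar>T (int s) N t\<bar> \<le> X)" if "0 \<le> X" for X
  proof -
    have "A p q r \<le> X \<longleftrightarrow> bounded r X"
      unfolding Ar using assms that by (intro height_ternary_le_iff) auto
    also have "\<dots> \<longleftrightarrow> (\<forall>N t. \<bar>T (int r) N t\<bar> \<le> X)"
      using bounded_imp_T_bounded[of r X] assms(3) by (auto simp: bounded_def)
    also have "\<dots> \<longleftrightarrow> (\<forall>N t. \<bar>T (int s) N t\<bar> \<le> X)" by (rule T_bounded_cong[OF cong])
    finally show ?thesis .
  qed
  have Ar0: "0 \<le> A p q r" unfolding Ar by (rule height_nonneg)
  \<comment> \<open>This value gives the lower bound 1, which is \<open>A p q s\<close>, in the case
    \<open>s = 2\<close>.\<close>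
  have T0: "T (int s) 0 0 = 1" using c_0 w_low[of 0] p_ge_2 by (simp add: T_def)
  consider "s = 1" | "s = 2" | "s \<ge> 3" using assms by linarith
  then show ?thesis
  proof cases
    case 1
    then show ?thesis using Ar0 r_iff[of 1] T_1_bounded by (simp add: A_def)
  next
    case 2
    have "\<bar>T (int s) 0 0\<bar> \<le> A p q r" using r_iff[OF Ar0] by blast
    moreover have "bounded 2 1" using cs 2 by (intro bounded_2) auto
    ultimately show ?thesis
      using T0 r_iff[of 2] bounded_imp_T_bounded_Suc[of 2 1] 2 by (simp add: A_def)
  next
    case 3
    then have As: "A p q s = height (ternary_incl_excl_poly p q s)" by (simp add: A_def)
    have s_iff: "A p q s \<le> X \<longleftrightarrow> bounded s X" if "0 \<le> X" for X
      unfolding As using cs assms that by (intro height_ternary_le_iff) auto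
    have As0: "0 \<le> A p q s" unfolding As by (rule height_nonneg)
    have "\<forall>N t. \<bar>T (int s) N t\<bar> \<le> A p q r" using r_iff[OF Ar0] by blast
    then have "A p q s \<le> A p q r" unfolding s_iff[OF Ar0] by (simp add: bounded_def)
    moreover have "bounded s (A p q s)" using s_iff[OF As0] by blast
    then have "A p q r \<le> A p q s + 1"
      using r_iff[of "A p q s + 1"] As0 bounded_imp_T_bounded_Suc assms(4) by simp
    ultimately show ?thesis by simp
  qed
qed

end

lemma A_commute: "A p q s = A q p s"
  unfolding A_def ternary_incl_excl_poly_def by (simp only: ac_simps)

theorem mainTheorem1:
  fixes p q r s :: nat
  assumes "p \<ge> 3" and "q \<ge> 3" and "r \<ge> 3"
    and "coprime p q" and "coprime q r" and "coprime p r"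
    and "s \<ge> 1"
    and "[int r = int s] (mod int (p * q)) \<or> [int r = - int s] (mod int (p * q))"
    and "r > max p q" and "max p q > s"
  shows "A p q s \<le> A p q r \<and> A p q r \<le> A p q s + 1"
proof (cases "p < q")
  case True
  then interpret coprime_generators p q
    using assms by unfold_locales auto
  show ?thesis using assms by (intro A_bounds) auto
next
  case False
  have "p \<noteq> q" using assms(1,4) by auto
  with False interpret coprime_generators q p
    using assms by unfold_locales (auto simp: coprime_commute)
  have "[int r = int s] (mod int (q * p)) \<or> [int r = - int s] (mod int (q * p))"
    using assms(8) by (simp only: mult.commute)
  then show ?thesis
    using assms unfolding A_commute[of p q] by (intro A_bounds) auto
qed

end
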